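(* Let $(\mathcal X,\mathcal F_{\mathcal X},\Pi_X)$ and $(\mathcal Y,\mathcal F_{\mathcal Y},\Pi_Y)$ be probability spaces and $\Pi=\Pi_X\otimes\Pi_Y$. Let $H_1$ be a $\Pi_Y$-reversible, positive Markov kernel on $\mathcal Y$ and $H_2$ a $\Pi_X$-reversible, positive Markov kernel on $\mathcal X$. Suppose that $H_1^2$ and $H_2^2$ each satisfy a weak Poincaré inequality: there are admissible functions $\beta_1,\beta_2$ with $$\mathrm{Var}_{\Pi_Y}(h)\le s\,\mathcal E_{\Pi_Y}(H_1^2,h)+\beta_1(s)\|h\|_{\mathrm{osc}}^2\qquad\forall s>0,\ h\in L^2(\Pi_Y),$$ $$\mathrm{Var}_{\Pi_X}(g)\le s\,\mathcal E_{\Pi_X}(H_2^2,g)+\beta_2(s)\|g\|_{\mathrm{osc}}^2\qquad\forall s>0,\ g\in L^2(\Pi_X).$$ Then the tensor product chain $H_1\otimes H_2$ satisfies the weak Poincaré inequality: for all $s>0$ and $f\in L^2_0(\Pi_X\otimes\Pi_Y)$, $$\|f\|_\Pi^2\le s\,\mathcal E_\Pi\big((H_1\otimes H_2)^2,f\big)+\beta(s)\|f\|_{\mathrm{osc}}^2,\qquad \beta(s):=\beta_1(s)+\beta_2(s).$$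
   Context: For a probability measure $\mu$: $L^2_0(\mu)$ is the space of mean-zero functions in $L^2(\mu)$, $\|f\|_\mu^2=\int f^2d\mu$, $\|f\|_{\mathrm{osc}}=\operatorname{ess\,sup}_\mu f-\operatorname{ess\,inf}_\mu f$. A $\mu$-invariant Markov kernel $T$ acts by $(Tf)(x)=\int f(x')T(x,dx')$ and $\mathcal E_\mu(T,f)=\langle (I-T)f,f\rangle_\mu$. A $\mu$-reversible $T$ is positive if $\langle Tf,f\rangle_\mu\ge0$ for all $f\in L^2(\mu)$. A function $\beta:(0,\infty)\to[0,\infty)$ is admissible if it is decreasing with $\lim_{s\to\infty}\beta(s)=0$. The tensor product $H_1\otimes H_2$ is the Markov kernel on $\mathcal X\times\mathcal Y$ given by the independent coupling $[H_1\otimes H_2]((x,y),(dx',dy'))=H_1(dy'|y)\,H_2(dx'|x)$. *)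

theory Defs
  imports "HOL-Probability.Probability"
begin

definition markov_kernel :: "'a measure \<Rightarrow> ('a \<Rightarrow> 'a measure) \<Rightarrow> bool" where
  "markov_kernel M K \<longleftrightarrow> K \<in> M \<rightarrow>\<^sub>M prob_algebra M"

text \<open>Detailed balance: the measure \<open>M(dx) K(x, dx')\<close> is symmetric.\<close>

definition reversible_kernel :: "'a measure \<Rightarrow> ('a \<Rightarrow> 'a measure) \<Rightarrow> bool" where
  "reversible_kernel M K \<longleftrightarrow>
     (\<forall>A\<in>sets M. \<forall>B\<in>sets M.
        (\<integral>\<^sup>+x\<in>A. emeasure (K x) B \<partial>M) = (\<integral>\<^sup>+x\<in>B. emeasure (K x) A \<partial>M))"

text \<open>Elements of \<open>L\<^sup>2\<close> are represented by functions rather than almost-everywhere classes; every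
  notion below depends only on the class when the kernel leaves \<open>M\<close> invariant.\<close>

definition L2 :: "'a measure \<Rightarrow> ('a \<Rightarrow> real) set" where
  "L2 M = {f \<in> borel_measurable M. integrable M (\<lambda>x. (f x)\<^sup>2)}"

definition L2_0 :: "'a measure \<Rightarrow> ('a \<Rightarrow> real) set" where
  "L2_0 M = {f \<in> L2 M. (\<integral>x. f x \<partial>M) = 0}"

definition L2_inner :: "'a measure \<Rightarrow> ('a \<Rightarrow> real) \<Rightarrow> ('a \<Rightarrow> real) \<Rightarrow> real" where
  "L2_inner M f g = (\<integral>x. f x * g x \<partial>M)"

definition kernel_op :: "('a \<Rightarrow> 'a measure) \<Rightarrow> ('a \<Rightarrow> real) \<Rightarrow> 'a \<Rightarrow> real" where
  "kernel_op K f x = (\<integral>x'. f x' \<partial>(K x))"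

definition kernel_square :: "('a \<Rightarrow> 'a measure) \<Rightarrow> 'a \<Rightarrow> 'a measure" where
  "kernel_square K x = K x \<bind> K"

definition positive_kernel :: "'a measure \<Rightarrow> ('a \<Rightarrow> 'a measure) \<Rightarrow> bool" where
  "positive_kernel M K \<longleftrightarrow> (\<forall>f\<in>L2 M. 0 \<le> L2_inner M (kernel_op K f) f)"

definition dirichlet_form :: "'a measure \<Rightarrow> ('a \<Rightarrow> 'a measure) \<Rightarrow> ('a \<Rightarrow> real) \<Rightarrow> real" where
  "dirichlet_form M K f = L2_inner M (\<lambda>x. f x - kernel_op K f x) f"

definition essinf :: "'a measure \<Rightarrow> ('a \<Rightarrow> ereal) \<Rightarrow> ereal" where
  "essinf M f = - esssup M (\<lambda>x. - f x)"

text \<open>The value is \<open>\<infinity>\<close> for essentially unbounded \<open>f\<close>. For a measurable real-valued \<open>f\<close> on a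
  probability space the supremum is not \<open>-\<infinity>\<close> and the infimum is not \<open>\<infinity>\<close>, so the difference is
  never degenerate.\<close>

definition osc_norm :: "'a measure \<Rightarrow> ('a \<Rightarrow> real) \<Rightarrow> ereal" where
  "osc_norm M f = esssup M (\<lambda>x. ereal (f x)) - essinf M (\<lambda>x. ereal (f x))"

text \<open>Only the values on \<open>(0, \<infinity>)\<close> matter; ``decreasing'' is understood in the weak sense.\<close>

definition admissible :: "(real \<Rightarrow> real) \<Rightarrow> bool" where
  "admissible \<beta> \<longleftrightarrow>
     (\<forall>s>0. 0 \<le> \<beta> s) \<and> antimono_on {0<..} \<beta> \<and> (\<beta> \<longlongrightarrow> 0) at_top"

text \<open>The inequality is between extended reals, with the convention \<open>0 * \<infinity> = 0\<close>, so that it is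
  trivial for essentially unbounded \<open>f\<close> exactly when \<open>\<beta> s > 0\<close>.\<close>

definition weak_poincare :: "'a measure \<Rightarrow> ('a \<Rightarrow> 'a measure) \<Rightarrow> (real \<Rightarrow> real) \<Rightarrow> bool" where
  "weak_poincare M K \<beta> \<longleftrightarrow>
     (\<forall>s>0. \<forall>f\<in>L2 M.
        ereal (prob_space.variance M f)
          \<le> ereal (s * dirichlet_form M K f) + ereal (\<beta> s) * (osc_norm M f)\<^sup>2)"

text \<open>\<open>H1\<close> acts on the second coordinate and \<open>H2\<close> on the first.\<close>

definition tensor_kernel ::
  "('b \<Rightarrow> 'b measure) \<Rightarrow> ('a \<Rightarrow> 'a measure) \<Rightarrow> 'a \<times> 'b \<Rightarrow> ('a \<times> 'b) measure" where
  "tensor_kernel H1 H2 = (\<lambda>(x, y). H2 x \<Otimes>\<^sub>M H1 y)"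

lemma markov_kernel_square:
  assumes "markov_kernel M K"
  shows "markov_kernel M (kernel_square K)"
  using assms unfolding markov_kernel_def kernel_square_def
  by (intro measurable_bind_prob_space) auto

lemma markov_kernel_tensor:
  assumes "markov_kernel N H1" and "markov_kernel M H2"
  shows "markov_kernel (M \<Otimes>\<^sub>M N) (tensor_kernel H1 H2)"
  using assms unfolding markov_kernel_def tensor_kernel_def by measurable

end

theory Submission
  imports Defs
begin

text \<open>Let \<open>A\<close> be \<open>H2\<close> acting on the first coordinate, \<open>B\<close> be \<open>H1\<close> acting on the second one and \<open>P\<close>
  be integration over the second coordinate. Then \<open>H1 \<otimes> H2 = A B = B A\<close>, \<open>P B = P\<close>, \<open>A P = P A\<close>, and by
  reversibility \<open>\<E>((H1 \<otimes> H2)\<^sup>2, f) = \<parallel>f\<parallel>\<^sup>2 - \<parallel>A B f\<parallel>\<^sup>2\<close>. Integrating the inequality for \<open>H1\<close> over the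
  sections \<open>f(x, \<cdot>)\<close> gives
  \<open>\<parallel>f\<parallel>\<^sup>2 - \<parallel>P f\<parallel>\<^sup>2 \<le> s (\<parallel>f\<parallel>\<^sup>2 - \<parallel>B f\<parallel>\<^sup>2) + \<beta>1(s) \<parallel>f\<parallel>\<^sub>o\<^sub>s\<^sub>c\<^sup>2\<close>, and the inequality for \<open>H2\<close> applied
  to \<open>P f\<close> gives \<open>\<parallel>P f\<parallel>\<^sup>2 \<le> s (\<parallel>P f\<parallel>\<^sup>2 - \<parallel>A P f\<parallel>\<^sup>2) + \<beta>2(s) \<parallel>f\<parallel>\<^sub>o\<^sub>s\<^sub>c\<^sup>2\<close>. As \<open>A\<close> is a contraction
  commuting with the projection \<open>P\<close> and \<open>P f = P B f\<close>, the energy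
  \<open>\<parallel>P f\<parallel>\<^sup>2 - \<parallel>A P f\<parallel>\<^sup>2\<close> is at most \<open>\<parallel>B f\<parallel>\<^sup>2 - \<parallel>A B f\<parallel>\<^sup>2\<close>, so that the two inequalities add up.\<close>

section \<open>Integration against mixtures of kernels\<close>

text \<open>Tonelli for the mixture gives a finite iterated integral, so the inner integral is
  finite almost everywhere and the Bochner integral there agrees with it.
  \<open>has_bochner_integral\<close> carries integrability and value together.\<close>

lemma integral_bind_nonneg:
  fixes f :: "'b \<Rightarrow> real"
  assumes M: "space M \<noteq> {}" and K: "K \<in> M \<rightarrow>\<^sub>M subprob_algebra N"
    and f: "integrable (M \<bind> K) f" and pos: "\<And>x. 0 \<le> f x"
  shows "AE x in M. integrable (K x) f"
    and "has_bochner_integral M (\<lambda>x. integral\<^sup>L (K x) f) (integral\<^sup>L (M \<bind> K) f)"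
proof -
  have [measurable]: "f \<in> borel_measurable N"
    using borel_measurable_integrable[OF f] sets_bind[OF sets_kernel[OF K] M]
    by (simp cong: measurable_cong_sets)
  note [measurable] = K
  have eq: "(\<integral>\<^sup>+x. \<integral>\<^sup>+y. f y \<partial>K x \<partial>M) = ennreal (integral\<^sup>L (M \<bind> K) f)"
    using nn_integral_bind[OF _ K, of "\<lambda>x. ennreal (f x)"] nn_integral_eq_integral[OF f] pos by simp
  have [measurable]: "(\<lambda>x. \<integral>\<^sup>+y. f y \<partial>K x) \<in> borel_measurable M"
    "(\<lambda>x. \<integral>y. f y \<partial>K x) \<in> borel_measurable M"
    by (rule measurable_compose[OF K]; measurable)+
  have "AE x in M. (\<integral>\<^sup>+y. f y \<partial>K x) \<noteq> \<infinity>"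
    by (intro nn_integral_PInf_AE) (auto simp: eq)
  with AE_space show int: "AE x in M. integrable (K x) f"
  proof eventually_elim
    case (elim x)
    then show ?case
      using pos subprob_measurableD[OF K] by (simp add: integrable_iff_bounded top.not_eq_extremum)
  qed
  have "(\<integral>\<^sup>+x. ennreal (integral\<^sup>L (K x) f) \<partial>M) = (\<integral>\<^sup>+x. \<integral>\<^sup>+y. f y \<partial>K x \<partial>M)"
    using int by (intro nn_integral_cong_AE, eventually_elim) (simp add: nn_integral_eq_integral pos)
  then show "has_bochner_integral M (\<lambda>x. integral\<^sup>L (K x) f) (integral\<^sup>L (M \<bind> K) f)"
    by (intro has_bochner_integral_nn_integral) (auto simp: eq pos)
qed

text \<open>Positive and negative parts reduce this to the nonnegative case. The difference of the
  two inner integrals is the inner integral of \<open>f\<close> only where both parts are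
  integrable, hence almost everywhere.\<close>

lemma integral_bind_integrable:
  fixes f :: "'b \<Rightarrow> real"
  assumes M: "space M \<noteq> {}" and K: "K \<in> M \<rightarrow>\<^sub>M subprob_algebra N"
    and f: "integrable (M \<bind> K) f"
  shows "AE x in M. integrable (K x) f"
    and "has_bochner_integral M (\<lambda>x. integral\<^sup>L (K x) f) (integral\<^sup>L (M \<bind> K) f)"
proof -
  have eq: "f = (\<lambda>x. max (f x) 0 - max (- f x) 0)"
    by auto
  have *: "integrable (M \<bind> K) (\<lambda>x. max (f x) 0)" "integrable (M \<bind> K) (\<lambda>x. max (- f x) 0)"
    using f by auto
  note p = integral_bind_nonneg[OF M K *(1), simplified]
    and n = integral_bind_nonneg[OF M K *(2), simplified]
  show "AE x in M. integrable (K x) f"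
    using p(1) n(1) by eventually_elim (subst eq, auto)
  have ae: "AE x in M. integral\<^sup>L (K x) (\<lambda>x. max (f x) 0) - integral\<^sup>L (K x) (\<lambda>x. max (- f x) 0)
      = integral\<^sup>L (K x) f"
    using p(1) n(1) by eventually_elim (subst (3) eq, auto)
  have [measurable]: "f \<in> borel_measurable N"
    using borel_measurable_integrable[OF f] sets_bind[OF sets_kernel[OF K] M]
    by (simp cong: measurable_cong_sets)
  have [measurable]: "(\<lambda>x. integral\<^sup>L (K x) f) \<in> borel_measurable M"
    by (rule measurable_compose[OF K]) measurable
  have "integral\<^sup>L (M \<bind> K) f
    = integral\<^sup>L (M \<bind> K) (\<lambda>x. max (f x) 0) - integral\<^sup>L (M \<bind> K) (\<lambda>x. max (- f x) 0)"
    using * by (subst eq) auto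
  with has_bochner_integral_diff[OF p(2) n(2)]
  show "has_bochner_integral M (\<lambda>x. integral\<^sup>L (K x) f) (integral\<^sup>L (M \<bind> K) f)"
    by (subst has_bochner_integral_cong_AE[OF _ _ ae, symmetric])
       (auto dest: borel_measurable_has_bochner_integral)
qed

lemma has_bochner_integral_mono_AE:
  fixes f g :: "'a \<Rightarrow> real"
  assumes f: "has_bochner_integral M f x" and g: "has_bochner_integral M g y"
    and "AE x in M. f x \<le> g x"
  shows "x \<le> y"
  using integral_mono_AE[OF integrable.intros[OF f] integrable.intros[OF g] assms(3)]
  unfolding has_bochner_integral_integral_eq[OF f] has_bochner_integral_integral_eq[OF g] .

section \<open>Square-integrable functions\<close>

lemma L2_D:
  assumes "f \<in> L2 M" shows "f \<in> borel_measurable M" "integrable M (\<lambda>x. (f x)\<^sup>2)"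
  using assms by (auto simp: L2_def)

lemma L2_inner_integrable:
  assumes "f \<in> L2 M" "g \<in> L2 M" shows "integrable M (\<lambda>x. f x * g x)"
proof (rule Bochner_Integration.integrable_bound)
  show "integrable M (\<lambda>x. (f x)\<^sup>2 + (g x)\<^sup>2)" "(\<lambda>x. f x * g x) \<in> borel_measurable M"
    using L2_D[OF assms(1)] L2_D[OF assms(2)] by auto
  have "\<bar>a * b\<bar> \<le> a\<^sup>2 + b\<^sup>2" for a b :: real
    using sum_squares_bound[of "\<bar>a\<bar>" "\<bar>b\<bar>"] mult_nonneg_nonneg[of "\<bar>a\<bar>" "\<bar>b\<bar>"]
    unfolding abs_mult power2_abs by linarith
  then show "AE x in M. norm (f x * g x) \<le> norm ((f x)\<^sup>2 + (g x)\<^sup>2)"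
    by (intro AE_I2) simp
qed

lemma (in prob_space) L2_integrable: "f \<in> L2 M \<Longrightarrow> integrable M f"
  by (auto simp: L2_def intro: square_integrable_imp_integrable)

lemma L2_diff:
  assumes "f \<in> L2 M" "g \<in> L2 M" shows "(\<lambda>x. f x - g x) \<in> L2 M"
  using L2_D[OF assms(1)] L2_D[OF assms(2)] L2_inner_integrable[OF assms]
  by (auto simp: L2_def power2_diff mult.assoc)

lemma L2_inner_diff:
  assumes "f \<in> L2 M" "g \<in> L2 M"
  shows "L2_inner M (\<lambda>x. f x - g x) (\<lambda>x. f x - g x)
    = L2_inner M f f - 2 * L2_inner M f g + L2_inner M g g"
proof -
  have "L2_inner M (\<lambda>x. f x - g x) (\<lambda>x. f x - g x)
    = (\<integral>x. (f x * f x - 2 * (f x * g x)) + g x * g x \<partial>M)"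
    unfolding L2_inner_def by (intro Bochner_Integration.integral_cong) (auto simp: algebra_simps)
  then show ?thesis
    using L2_inner_integrable[OF assms(1,1)] L2_inner_integrable[OF assms(2,2)]
      L2_inner_integrable[OF assms] by (simp add: L2_inner_def)
qed

text \<open>Operator identities below hold only almost everywhere, since functions stand for
  classes; this carries them into norms and inner products.\<close>

lemma L2_inner_cong_AE:
  assumes "f \<in> borel_measurable M" "f' \<in> borel_measurable M" "g \<in> borel_measurable M"
    "g' \<in> borel_measurable M" "AE x in M. f x = f' x" "AE x in M. g x = g' x"
  shows "L2_inner M f g = L2_inner M f' g'"
proof -
  have "AE x in M. f x * g x = f' x * g' x"
    using assms(5,6) by eventually_elim simp
  then show ?thesis
    unfolding L2_inner_def using assms(1-4) by (intro integral_cong_AE) auto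
qed

lemma L2_inner_commute: "L2_inner M f g = L2_inner M g f"
  by (simp add: L2_inner_def mult.commute)

lemma L2_inner_self: "L2_inner M f f = (\<integral>x. (f x)\<^sup>2 \<partial>M)"
  by (simp add: L2_inner_def power2_eq_square)

section \<open>Reversible kernels\<close>

locale reversible_markov = prob_space M for M :: "'a measure" +
  fixes K :: "'a \<Rightarrow> 'a measure"
  assumes markov: "markov_kernel M K" and reversible: "reversible_kernel M K"
begin

lemma kernel_measurable [measurable]: "K \<in> M \<rightarrow>\<^sub>M prob_algebra M"
  using markov by (simp add: markov_kernel_def)

lemma kernel_subprob [measurable]: "K \<in> M \<rightarrow>\<^sub>M subprob_algebra M"
  by (rule measurable_prob_algebraD[OF kernel_measurable])

lemma
  assumes "x \<in> space M"
  shows prob_space_kernel: "prob_space (K x)" and sets_kernel_eq: "sets (K x) = sets M"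
  using measurable_space[OF kernel_measurable assms] by (auto simp: space_prob_algebra)

text \<open>Detailed balance between the whole space and \<open>A\<close> gives invariance, because
  \<open>K x\<close> has total mass 1.\<close>

lemma bind_kernel: "M \<bind> K = M"
proof (rule measure_eqI)
  show sets: "sets (M \<bind> K) = sets M"
    by (rule sets_bind[OF sets_kernel_eq not_empty])
  fix A assume "A \<in> sets (M \<bind> K)"
  then have A: "A \<in> sets M" by (simp add: sets)
  have "emeasure (M \<bind> K) A = (\<integral>\<^sup>+x. emeasure (K x) A \<partial>M)"
    by (rule emeasure_bind[OF not_empty kernel_subprob A])
  also have "\<dots> = (\<integral>\<^sup>+x\<in>space M. emeasure (K x) A \<partial>M)"
    by (intro nn_integral_cong) simp
  also have "\<dots> = (\<integral>\<^sup>+x\<in>A. emeasure (K x) (space M) \<partial>M)"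
    using reversible A by (simp add: reversible_kernel_def)
  also have "\<dots> = (\<integral>\<^sup>+x. indicator A x \<partial>M)"
    using prob_space.emeasure_space_1[OF prob_space_kernel] sets_eq_imp_space_eq[OF sets_kernel_eq]
    by (intro nn_integral_cong) simp
  finally show "emeasure (M \<bind> K) A = emeasure M A"
    using A by simp
qed

text \<open>The law of two consecutive states of the stationary chain. Reversibility becomes its
  symmetry under exchange of the coordinates, from which the integral identities follow by a change
  of variables.\<close>

definition joint :: "('a \<times> 'a) measure" where
  "joint = M \<bind> (\<lambda>x. distr (K x) (M \<Otimes>\<^sub>M M) (Pair x))"

lemma joint_kernel [measurable]:
  "(\<lambda>x. distr (K x) (M \<Otimes>\<^sub>M M) (Pair x)) \<in> M \<rightarrow>\<^sub>M subprob_algebra (M \<Otimes>\<^sub>M M)"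
  by (rule measurable_distr2[where M=M]) auto

lemma sets_joint [measurable_cong]: "sets joint = sets (M \<Otimes>\<^sub>M M)"
  unfolding joint_def by (rule sets_bind[OF _ not_empty]) simp

lemma nn_integral_joint:
  assumes [measurable]: "h \<in> borel_measurable (M \<Otimes>\<^sub>M M)"
  shows "(\<integral>\<^sup>+z. h z \<partial>joint) = (\<integral>\<^sup>+x. \<integral>\<^sup>+y. h (x, y) \<partial>K x \<partial>M)"
  unfolding joint_def nn_integral_bind[OF assms joint_kernel]
proof (intro nn_integral_cong)
  fix x assume x [measurable]: "x \<in> space M"
  have [measurable_cong]: "sets (K x) = sets M"
    by (rule sets_kernel_eq[OF x])
  show "integral\<^sup>N (distr (K x) (M \<Otimes>\<^sub>M M) (Pair x)) h = (\<integral>\<^sup>+y. h (x, y) \<partial>K x)"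
    using x by (intro nn_integral_distr) (auto simp: subprob_measurableD(3)[OF kernel_subprob x])
qed

lemma emeasure_joint_times:
  assumes [measurable]: "A \<in> sets M" "B \<in> sets M"
  shows "emeasure joint (A \<times> B) = (\<integral>\<^sup>+x\<in>A. emeasure (K x) B \<partial>M)"
proof -
  have "emeasure joint (A \<times> B) = (\<integral>\<^sup>+z. indicator (A \<times> B) z \<partial>joint)"
    by (rule nn_integral_indicator[symmetric]) measurable
  also have "\<dots> = (\<integral>\<^sup>+x. \<integral>\<^sup>+y. indicator (A \<times> B) (x, y) \<partial>K x \<partial>M)"
    by (rule nn_integral_joint) measurable
  also have "\<dots> = (\<integral>\<^sup>+x. \<integral>\<^sup>+y. indicator A x * indicator B y \<partial>K x \<partial>M)"
    by (simp add: indicator_times)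
  also have "\<dots> = (\<integral>\<^sup>+x\<in>A. emeasure (K x) B \<partial>M)"
    using assms by (intro nn_integral_cong) (simp add: nn_integral_cmult sets_kernel_eq mult.commute)
  finally show ?thesis .
qed

text \<open>Detailed balance is equality of the two measures on rectangles, which form an
  intersection-stable generator.\<close>

lemma joint_swap: "distr joint (M \<Otimes>\<^sub>M M) (\<lambda>(x, y). (y, x)) = joint"
proof (rule measure_eqI_generator_eq)
  let ?E = "{a \<times> b |a b. a \<in> sets M \<and> b \<in> sets M}"
  show "Int_stable ?E" by (rule Int_stable_pair_measure_generator)
  show "?E \<subseteq> Pow (space M \<times> space M)"
    using sets.sets_into_space by blast
  show "sets (distr joint (M \<Otimes>\<^sub>M M) (\<lambda>(x, y). (y, x))) = sigma_sets (space M \<times> space M) ?E"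
    "sets joint = sigma_sets (space M \<times> space M) ?E"
    by (simp_all add: sets_joint sets_pair_measure)
  show "range (\<lambda>_::nat. space M \<times> space M) \<subseteq> ?E" by auto
  show "(\<Union>i::nat. space M \<times> space M) = space M \<times> space M" by simp
  fix X assume "X \<in> ?E"
  then obtain a b where X: "X = a \<times> b" and ab [measurable]: "a \<in> sets M" "b \<in> sets M"
    by auto
  have "(\<lambda>(x, y). (y, x)) -` X \<inter> space joint = b \<times> a"
    using sets.sets_into_space[OF ab(1)] sets.sets_into_space[OF ab(2)]
    by (auto simp: X sets_eq_imp_space_eq[OF sets_joint] space_pair_measure)
  then have "emeasure (distr joint (M \<Otimes>\<^sub>M M) (\<lambda>(x, y). (y, x))) X = emeasure joint (b \<times> a)"
    by (subst emeasure_distr) (auto simp: X)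
  also have "\<dots> = emeasure joint X"
    using reversible ab by (simp add: emeasure_joint_times X reversible_kernel_def)
  finally show "emeasure (distr joint (M \<Otimes>\<^sub>M M) (\<lambda>(x, y). (y, x))) X = emeasure joint X" .
next
  \<comment> \<open>Uniqueness from a generator needs an exhaustion of finite mass; as
    \<open>joint\<close> is a probability measure, the constant sequence will do.\<close>
  have "prob_space (distr (K x) (M \<Otimes>\<^sub>M M) (Pair x))" if "x \<in> space M" for x
    using that by (intro prob_space.prob_space_distr prob_space_kernel)
      (auto simp: measurable_cong_sets[OF sets_kernel_eq refl])
  then have "prob_space joint"
    unfolding joint_def by (intro prob_space_bind[OF _ joint_kernel] AE_I2)
  then interpret J: prob_space joint .
  have [simp]: "space M \<times> space M = space joint"
    by (simp add: sets_eq_imp_space_eq[OF sets_joint] space_pair_measure)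
  show "emeasure (distr joint (M \<Otimes>\<^sub>M M) (\<lambda>(x, y). (y, x))) (space M \<times> space M) \<noteq> \<infinity>"
    by (subst emeasure_distr) (auto simp: sets_eq_imp_space_eq[OF sets_joint])
qed

text \<open>Each side integrates a product of a function of the first state and one of the second
  against \<open>joint\<close>, and exchanging the states swaps the two sides. This extends detailed
  balance from sets to nonnegative functions, as composing kernels requires.\<close>

lemma nn_integral_reversible:
  assumes [measurable]: "u \<in> borel_measurable M" "v \<in> borel_measurable M"
  shows "(\<integral>\<^sup>+x. v x * (\<integral>\<^sup>+y. u y \<partial>K x) \<partial>M) = (\<integral>\<^sup>+x. u x * (\<integral>\<^sup>+y. v y \<partial>K x) \<partial>M)"
proof -
  have *: "(\<integral>\<^sup>+x. w x * (\<integral>\<^sup>+y. w' y \<partial>K x) \<partial>M) = (\<integral>\<^sup>+z. w (fst z) * w' (snd z) \<partial>joint)"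
    if [measurable]: "w \<in> borel_measurable M" "w' \<in> borel_measurable M" for w w'
    by (subst nn_integral_joint)
       (auto intro!: nn_integral_cong nn_integral_cmult[symmetric]
         simp: measurable_cong_sets[OF sets_kernel_eq refl])
  have "(\<integral>\<^sup>+z. v (fst z) * u (snd z) \<partial>joint) = (\<integral>\<^sup>+z. v (snd z) * u (fst z) \<partial>joint)"
    by (subst joint_swap[symmetric], subst nn_integral_distr) (auto simp: split_beta)
  then show ?thesis
    by (simp add: * mult.commute)
qed

section \<open>The kernel as a self-adjoint contraction of L2\<close>

lemma kernel_op_measurable [measurable]:
  "f \<in> borel_measurable M \<Longrightarrow> kernel_op K f \<in> borel_measurable M"
  unfolding kernel_op_def by (rule measurable_compose[OF kernel_subprob]) measurable

text \<open>By invariance \<open>f\<close> is integrable against the mixture of the measures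
  \<open>K x\<close>. Outside a null set \<open>kernel_op\<close> is therefore a genuine integral
  and not the default value 0.\<close>

lemma AE_integrable_kernel:
  fixes f :: "'a \<Rightarrow> real"
  shows "integrable M f \<Longrightarrow> AE x in M. integrable (K x) f"
  using integral_bind_integrable(1)[OF not_empty kernel_subprob, of f] by (simp add: bind_kernel)

lemma integral_kernel_op:
  "integrable M f \<Longrightarrow> has_bochner_integral M (kernel_op K f) (integral\<^sup>L M f)"
  using integral_bind_integrable(2)[OF not_empty kernel_subprob, of f]
  by (simp add: bind_kernel kernel_op_def[abs_def])

text \<open>By invariance a null set of \<open>M\<close> is null for \<open>K x\<close> for almost
  every \<open>x\<close>, so the operator is well defined on classes.\<close>

lemma kernel_op_cong_AE:
  assumes [measurable]: "f \<in> borel_measurable M" "g \<in> borel_measurable M"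
    and "AE x in M. f x = g x"
  shows "AE x in M. kernel_op K f x = kernel_op K g x"
proof -
  have "AE x in M. AE y in K x. f y = g y"
    using assms(3) AE_bind[OF kernel_subprob, of "\<lambda>x. f x = g x"] unfolding bind_kernel by simp
  with AE_space show ?thesis
  proof eventually_elim
    case (elim x)
    then show ?case
      unfolding kernel_op_def
      by (intro integral_cong_AE) (auto simp: measurable_cong_sets[OF sets_kernel_eq refl])
  qed
qed

lemma kernel_op_diff:
  assumes "integrable M f" "integrable M g"
  shows "AE x in M. kernel_op K (\<lambda>x. f x - g x) x = kernel_op K f x - kernel_op K g x"
  using AE_integrable_kernel[OF assms(1)] AE_integrable_kernel[OF assms(2)]
  by eventually_elim (simp add: kernel_op_def)

text \<open>Nonnegativity of the variance under \<open>K x\<close> gives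
  \<open>(K f)^2 \<le> K (f^2)\<close> almost everywhere, and invariance integrates the right-hand
  side to the squared norm of \<open>f\<close>.\<close>

lemma
  assumes f: "f \<in> L2 M"
  shows kernel_op_L2: "kernel_op K f \<in> L2 M"
    and kernel_op_contraction: "L2_inner M (kernel_op K f) (kernel_op K f) \<le> L2_inner M f f"
proof -
  note [measurable] = L2_D(1)[OF f]
  note sq = integral_kernel_op[OF L2_D(2)[OF f]]
  have le: "AE x in M. (kernel_op K f x)\<^sup>2 \<le> kernel_op K (\<lambda>x. (f x)\<^sup>2) x"
    using AE_space AE_integrable_kernel[OF L2_integrable[OF f]] AE_integrable_kernel[OF L2_D(2)[OF f]]
  proof eventually_elim
    case (elim x)
    interpret Kx: prob_space "K x" by (rule prob_space_kernel[OF elim(1)])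
    have "0 \<le> Kx.variance f"
      by (rule Bochner_Integration.integral_nonneg) simp
    then show ?case
      using Kx.variance_eq[OF elim(2,3)] by (simp add: kernel_op_def)
  qed
  have int: "integrable M (\<lambda>x. (kernel_op K f x)\<^sup>2)"
    by (rule Bochner_Integration.integrable_bound[OF integrable.intros[OF sq]])
       (use le in \<open>auto elim!: eventually_mono\<close>)
  then show "kernel_op K f \<in> L2 M"
    by (simp add: L2_def)
  show "L2_inner M (kernel_op K f) (kernel_op K f) \<le> L2_inner M f f"
    using integral_mono_AE[OF int integrable.intros[OF sq] le]
      has_bochner_integral_integral_eq[OF sq] by (simp add: L2_inner_self)
qed

text \<open>Both inner products are integrals of products of the form
  \<open>v (fst z) * u (snd z)\<close> against \<open>joint\<close>, which is symmetric.\<close>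

lemma kernel_op_self_adjoint:
  assumes f: "f \<in> L2 M" and g: "g \<in> L2 M"
  shows "L2_inner M (kernel_op K f) g = L2_inner M f (kernel_op K g)"
proof -
  note [measurable] = L2_D(1)[OF f] L2_D(1)[OF g]
  have sq: "integrable M (\<lambda>x. (h x)\<^sup>2) \<Longrightarrow> integrable joint (\<lambda>z. (h (fst z))\<^sup>2)"
    if [measurable]: "h \<in> borel_measurable M" for h :: "'a \<Rightarrow> real"
  proof -
    assume "integrable M (\<lambda>x. (h x)\<^sup>2)"
    moreover have "(\<integral>\<^sup>+z. ennreal ((h (fst z))\<^sup>2) \<partial>joint) = (\<integral>\<^sup>+x. ennreal ((h x)\<^sup>2) \<partial>M)"
      by (subst nn_integral_joint)
         (auto intro!: nn_integral_cong simp: prob_space.emeasure_space_1[OF prob_space_kernel])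
    ultimately show ?thesis
      by (simp add: integrable_iff_bounded)
  qed
  \<comment> \<open>Both marginals of \<open>joint\<close> are \<open>M\<close>:
    square-integrability is read off for the first coordinate and moved to the second by symmetry.
    This makes the product integrable, so the iterated integral is legitimate.\<close>
  have swap: "integrable joint (\<lambda>z. h (snd z)) \<longleftrightarrow> integrable joint (\<lambda>z. h (fst z))"
    if [measurable]: "h \<in> borel_measurable M" for h :: "'a \<Rightarrow> real"
    by (subst joint_swap[symmetric], subst integrable_distr_eq) (auto simp: split_beta)
  have *: "L2_inner M v (kernel_op K u) = (\<integral>z. v (fst z) * u (snd z) \<partial>joint)"
    if u: "u \<in> L2 M" and v: "v \<in> L2 M" for u v
  proof -
    note [measurable] = L2_D(1)[OF u] L2_D(1)[OF v]
    have "(\<lambda>z. v (fst z)) \<in> L2 joint" "(\<lambda>z. u (snd z)) \<in> L2 joint"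
      using sq[OF _ L2_D(2)[OF u]] sq[OF _ L2_D(2)[OF v]] swap[of "\<lambda>x. (u x)\<^sup>2"]
      by (auto simp: L2_def)
    then have "integrable joint (\<lambda>z. v (fst z) * u (snd z))"
      by (rule L2_inner_integrable)
    then have "(\<integral>z. v (fst z) * u (snd z) \<partial>joint)
      = (\<integral>x. \<integral>z. v (fst z) * u (snd z) \<partial>distr (K x) (M \<Otimes>\<^sub>M M) (Pair x) \<partial>M)"
      using integral_bind_integrable(2)[OF not_empty joint_kernel]
      by (simp add: joint_def has_bochner_integral_iff)
    also have "\<dots> = (\<integral>x. v x * kernel_op K u x \<partial>M)"
    proof (intro Bochner_Integration.integral_cong refl)
      fix x assume x [measurable]: "x \<in> space M"
      have [measurable_cong]: "sets (K x) = sets M"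
        by (rule sets_kernel_eq[OF x])
      show "(\<integral>z. v (fst z) * u (snd z) \<partial>distr (K x) (M \<Otimes>\<^sub>M M) (Pair x)) = v x * kernel_op K u x"
        by (subst integral_distr)
           (auto simp: kernel_op_def subprob_measurableD(3)[OF kernel_subprob x] x)
    qed
    finally show ?thesis
      by (simp add: L2_inner_def)
  qed
  have "(\<integral>z. g (fst z) * f (snd z) \<partial>joint) = (\<integral>z. f (fst z) * g (snd z) \<partial>joint)"
    by (subst joint_swap[symmetric], subst integral_distr) (auto simp: split_beta mult.commute)
  then show ?thesis
    using *[OF f g] *[OF g f] by (simp add: L2_inner_commute)
qed

text \<open>The composite also leaves \<open>M\<close> invariant, so \<open>f\<close> is integrable
  against \<open>K x \<bind> L\<close> for almost every \<open>x\<close>. The composite enters as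
  \<open>R\<close>, equal to it on \<open>space M\<close>, so that squares, tensor kernels and
  projections can be inserted directly.\<close>

lemma kernel_op_bind:
  assumes L: "reversible_markov M L" and f: "integrable M f"
    and eq: "\<And>x. x \<in> space M \<Longrightarrow> K x \<bind> L = R x"
  shows "AE x in M. kernel_op R f x = kernel_op K (kernel_op L f) x"
proof -
  interpret L: reversible_markov M L by fact
  have "M \<bind> (\<lambda>x. K x \<bind> L) = M"
    using bind_assoc[OF kernel_subprob L.kernel_subprob] by (simp add: bind_kernel L.bind_kernel)
  moreover have "(\<lambda>x. K x \<bind> L) \<in> M \<rightarrow>\<^sub>M subprob_algebra M"
    by (rule measurable_bind2[OF kernel_subprob L.kernel_subprob])
  ultimately have "AE x in M. integrable (K x \<bind> L) f"
    using integral_bind_integrable(1)[OF not_empty, of "\<lambda>x. K x \<bind> L" M f] f by simp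
  with AE_space show ?thesis
  proof eventually_elim
    case (elim x)
    have "space (K x) \<noteq> {}" "L \<in> K x \<rightarrow>\<^sub>M subprob_algebra M"
      using prob_space.not_empty[OF prob_space_kernel[OF elim(1)]] L.kernel_subprob
      by (auto simp: measurable_cong_sets[OF sets_kernel_eq[OF elim(1)] refl])
    from integral_bind_integrable(2)[OF this elim(2)] show ?case
      by (simp add: kernel_op_def[abs_def] eq[OF elim(1), symmetric] has_bochner_integral_iff)
  qed
qed

text \<open>Self-adjointness moves one of the two factors \<open>K\<close> to the other side, which
  leaves a difference of squared norms.\<close>

lemma dirichlet_form_square:
  assumes f: "f \<in> L2 M"
  shows "dirichlet_form M (kernel_square K) f
    = L2_inner M f f - L2_inner M (kernel_op K f) (kernel_op K f)"
proof -
  note [measurable] = L2_D(1)[OF f]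
  have Kf: "kernel_op K f \<in> L2 M" and KKf: "kernel_op K (kernel_op K f) \<in> L2 M"
    by (intro kernel_op_L2 f)+
  have sq: "AE x in M. kernel_op (kernel_square K) f x = kernel_op K (kernel_op K f) x"
    by (rule kernel_op_bind[OF _ L2_integrable[OF f]]) (auto simp: kernel_square_def, unfold_locales)
  have [measurable]: "kernel_op (kernel_square K) f \<in> borel_measurable M"
    unfolding kernel_op_def kernel_square_def
    by (rule measurable_compose[OF measurable_bind2[OF kernel_subprob kernel_subprob]]) measurable
  have "dirichlet_form M (kernel_square K) f
    = L2_inner M (\<lambda>x. f x - kernel_op K (kernel_op K f) x) f"
    unfolding dirichlet_form_def
    by (intro L2_inner_cong_AE) (use sq in \<open>auto elim!: eventually_mono\<close>)
  also have "\<dots> = L2_inner M f f - L2_inner M (kernel_op K (kernel_op K f)) f"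
    using L2_inner_integrable[OF f f] L2_inner_integrable[OF KKf f]
    by (simp add: L2_inner_def left_diff_distrib)
  finally show ?thesis
    by (simp add: kernel_op_self_adjoint[OF Kf f])
qed

end

text \<open>The kernel form of the fact that a product of commuting self-adjoint operators is
  self-adjoint; the two assumptions on \<open>R\<close> say that \<open>K\<close> and
  \<open>L\<close> commute.\<close>

lemma reversible_markov_bind:
  assumes K: "reversible_markov M K" and L: "reversible_markov M L"
    and R: "\<And>x. x \<in> space M \<Longrightarrow> K x \<bind> L = R x" "\<And>x. x \<in> space M \<Longrightarrow> L x \<bind> K = R x"
  shows "reversible_markov M R"
proof -
  interpret K: reversible_markov M K by fact
  interpret L: reversible_markov M L by fact
  have meas: "R \<in> M \<rightarrow>\<^sub>M prob_algebra M"
    using measurable_bind_prob_space[OF K.kernel_measurable L.kernel_measurable]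
    by (simp add: R(1) cong: measurable_cong)
  have em: "emeasure (R x) A = (\<integral>\<^sup>+y. emeasure (L' y) A \<partial>K' x)"
    if K': "reversible_markov M K'" and L': "reversible_markov M L'" and eq: "K' x \<bind> L' = R x"
      and x: "x \<in> space M" and A: "A \<in> sets M" for K' L' x A
  proof -
    interpret K': reversible_markov M K' by fact
    interpret L': reversible_markov M L' by fact
    show ?thesis
      using emeasure_bind_prob_algebra[OF measurable_space[OF K'.kernel_measurable x] L'.kernel_measurable A]
      by (simp add: eq)
  qed
  have "(\<integral>\<^sup>+x\<in>A. emeasure (R x) B \<partial>M) = (\<integral>\<^sup>+x\<in>B. emeasure (R x) A \<partial>M)"
    if [measurable]: "A \<in> sets M" "B \<in> sets M" for A B
  proof -
    have ind: "(\<integral>\<^sup>+y. indicator C y \<partial>K' x) = emeasure (K' x) C"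
      if "reversible_markov M K'" "C \<in> sets M" "x \<in> space M" for K' C x
      using reversible_markov.sets_kernel_eq[OF that(1,3)] that(2) by simp
    have "(\<integral>\<^sup>+x\<in>A. emeasure (R x) B \<partial>M) = (\<integral>\<^sup>+x. indicator A x * (\<integral>\<^sup>+y. emeasure (L y) B \<partial>K x) \<partial>M)"
      by (intro nn_integral_cong) (simp add: em[OF K L R(1)] mult.commute)
    \<comment> \<open>Reversibility of \<open>K\<close> moves the factor \<open>A\<close> inside,
      then that of \<open>L\<close> moves \<open>B\<close> outside. The kernels now appear in the
      opposite order, which commutation turns back into \<open>R\<close>.\<close>
    also have "\<dots> = (\<integral>\<^sup>+x. emeasure (L x) B * (\<integral>\<^sup>+y. indicator A y \<partial>K x) \<partial>M)"
      by (rule K.nn_integral_reversible) measurable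
    also have "\<dots> = (\<integral>\<^sup>+x. emeasure (K x) A * (\<integral>\<^sup>+y. indicator B y \<partial>L x) \<partial>M)"
      by (intro nn_integral_cong) (simp add: ind[OF K] ind[OF L] mult.commute)
    also have "\<dots> = (\<integral>\<^sup>+x. indicator B x * (\<integral>\<^sup>+y. emeasure (K y) A \<partial>L x) \<partial>M)"
      by (rule L.nn_integral_reversible) measurable
    also have "\<dots> = (\<integral>\<^sup>+x\<in>B. emeasure (R x) A \<partial>M)"
      by (intro nn_integral_cong) (simp add: em[OF L K R(2)] mult.commute)
    finally show ?thesis .
  qed
  then show ?thesis
    by unfold_locales (auto simp: markov_kernel_def reversible_kernel_def meas)
qed

section \<open>Tensor kernels\<close>

text \<open>A product with a point mass is a push-forward along a section; integrals against a
  kernel that fixes one coordinate thus become integrals over the other.\<close>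

lemma pair_return_left:
  assumes x [measurable]: "x \<in> space M" and N': "prob_space N'" and [measurable_cong]: "sets N' = sets N"
  shows "return M x \<Otimes>\<^sub>M N' = distr N' (M \<Otimes>\<^sub>M N) (Pair x)"
proof (rule pair_measure_eqI)
  interpret N': prob_space N' by fact
  show "sigma_finite_measure N'" ..
  show "sigma_finite_measure (return M x)"
    by (intro prob_space_imp_sigma_finite prob_space_return x)
  show "sets (return M x \<Otimes>\<^sub>M N') = sets (distr N' (M \<Otimes>\<^sub>M N) (Pair x))"
    by (simp add: assms(3) cong: sets_pair_measure_cong)
  fix A B assume "A \<in> sets (return M x)" "B \<in> sets N'"
  then have [measurable]: "A \<in> sets M" "B \<in> sets N" using assms(3) by auto
  have "Pair x -` (A \<times> B) \<inter> space N' = (if x \<in> A then B else {})"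
    using \<open>B \<in> sets N'\<close> sets.sets_into_space by auto
  then show "emeasure (return M x) A * emeasure N' B
    = emeasure (distr N' (M \<Otimes>\<^sub>M N) (Pair x)) (A \<times> B)"
    by (subst emeasure_distr) auto
qed

lemma pair_return_right:
  assumes y [measurable]: "y \<in> space N" and M': "prob_space M'" and [measurable_cong]: "sets M' = sets M"
  shows "M' \<Otimes>\<^sub>M return N y = distr M' (M \<Otimes>\<^sub>M N) (\<lambda>x. (x, y))"
proof (rule pair_measure_eqI)
  interpret M': prob_space M' by fact
  show "sigma_finite_measure M'" ..
  show "sigma_finite_measure (return N y)"
    by (intro prob_space_imp_sigma_finite prob_space_return y)
  show "sets (M' \<Otimes>\<^sub>M return N y) = sets (distr M' (M \<Otimes>\<^sub>M N) (\<lambda>x. (x, y)))"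
    by (simp add: assms(3) cong: sets_pair_measure_cong)
  fix A B assume "A \<in> sets M'" "B \<in> sets (return N y)"
  then have [measurable]: "A \<in> sets M" "B \<in> sets N" using assms(3) by auto
  have "(\<lambda>x. (x, y)) -` (A \<times> B) \<inter> space M' = (if y \<in> B then A else {})"
    using \<open>A \<in> sets M'\<close> sets.sets_into_space by auto
  then show "emeasure M' A * emeasure (return N y) B
    = emeasure (distr M' (M \<Otimes>\<^sub>M N) (\<lambda>x. (x, y))) (A \<times> B)"
    by (subst emeasure_distr) auto
qed

lemma markov_kernelD:
  assumes "markov_kernel M K" "x \<in> space M"
  shows "prob_space (K x)" "sets (K x) = sets M" "space (K x) = space M"
    "K x \<in> space (prob_algebra M)"
proof -
  show *: "K x \<in> space (prob_algebra M)"
    using assms unfolding markov_kernel_def by (rule measurable_space)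
  then show "prob_space (K x)" "sets (K x) = sets M"
    by (auto simp: space_prob_algebra)
  then show "space (K x) = space M"
    by (intro sets_eq_imp_space_eq)
qed

text \<open>On a rectangle the transition probability factorises, and Tonelli separates the two
  steps. Identities between compositions of tensor kernels can then be checked
  coordinatewise.\<close>

lemma tensor_kernel_bind:
  assumes K: "markov_kernel M K" and K': "markov_kernel M K'"
    and L: "markov_kernel N L" and L': "markov_kernel N L'"
    and x: "x \<in> space M" and y: "y \<in> space N"
  shows "tensor_kernel L K (x, y) \<bind> tensor_kernel L' K' = (K x \<bind> K') \<Otimes>\<^sub>M (L y \<bind> L')"
proof (rule pair_measure_eqI[symmetric])
  note Kx = markov_kernelD[OF K x] and Ly = markov_kernelD[OF L y]
  have [measurable]: "K' \<in> M \<rightarrow>\<^sub>M prob_algebra M" "L' \<in> N \<rightarrow>\<^sub>M prob_algebra N"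
    using K' L' by (simp_all add: markov_kernel_def)
  note T' = markov_kernel_tensor[OF L' K', unfolded markov_kernel_def]
  have z: "(x, y) \<in> space (M \<Otimes>\<^sub>M N)"
    using x y by (simp add: space_pair_measure)
  note T = markov_kernelD[OF markov_kernel_tensor[OF L K] z]
  have sets: "sets (K x \<bind> K') = sets M" "sets (L y \<bind> L') = sets N"
    using K' L' by (auto intro!: sets_bind'[OF Kx(4)] sets_bind'[OF Ly(4)] simp: markov_kernel_def)
  interpret Ky: pair_prob_space "K x" "L y"
    using Kx Ly by (simp add: pair_prob_space_def pair_sigma_finite_def prob_space_imp_sigma_finite)
  show "sigma_finite_measure (K x \<bind> K')" "sigma_finite_measure (L y \<bind> L')"
    by (intro prob_space_imp_sigma_finite prob_space_bind'[OF Kx(4) K'[unfolded markov_kernel_def]]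
          prob_space_bind'[OF Ly(4) L'[unfolded markov_kernel_def]])+
  show "sets ((K x \<bind> K') \<Otimes>\<^sub>M (L y \<bind> L')) = sets (tensor_kernel L K (x, y) \<bind> tensor_kernel L' K')"
    using sets_bind'[OF T(4) T'] by (simp add: sets cong: sets_pair_measure_cong)
  fix A B assume "A \<in> sets (K x \<bind> K')" "B \<in> sets (L y \<bind> L')"
  then have AB [measurable]: "A \<in> sets M" "B \<in> sets N" by (simp_all add: sets)
  have [measurable_cong]: "sets (K x) = sets M" "sets (L y) = sets N"
    using Kx Ly by auto
  have [measurable]: "(\<lambda>x. emeasure (K' x) A) \<in> borel_measurable M" "(\<lambda>y. emeasure (L' y) B) \<in> borel_measurable N"
    using measurable_emeasure_kernel[OF measurable_prob_algebraD[OF K'[unfolded markov_kernel_def]] AB(1)]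
      measurable_emeasure_kernel[OF measurable_prob_algebraD[OF L'[unfolded markov_kernel_def]] AB(2)]
    by auto
  have "emeasure (tensor_kernel L K (x, y) \<bind> tensor_kernel L' K') (A \<times> B)
    = (\<integral>\<^sup>+z. emeasure (tensor_kernel L' K' z) (A \<times> B) \<partial>(K x \<Otimes>\<^sub>M L y))"
    by (subst emeasure_bind_prob_algebra[OF T(4) T']) (auto simp: tensor_kernel_def)
  also have "\<dots> = (\<integral>\<^sup>+z. emeasure (K' (fst z)) A * emeasure (L' (snd z)) B \<partial>(K x \<Otimes>\<^sub>M L y))"
  proof (intro nn_integral_cong)
    fix z assume "z \<in> space (K x \<Otimes>\<^sub>M L y)"
    then have z: "fst z \<in> space M" "snd z \<in> space N"
      using Kx Ly by (auto simp: space_pair_measure)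
    interpret L'z: prob_space "L' (snd z)" by (rule markov_kernelD[OF L' z(2)])
    show "emeasure (tensor_kernel L' K' z) (A \<times> B) = emeasure (K' (fst z)) A * emeasure (L' (snd z)) B"
      using markov_kernelD(2)[OF L' z(2)] markov_kernelD(2)[OF K' z(1)] AB
      by (simp add: tensor_kernel_def split_beta L'z.emeasure_pair_measure_Times)
  qed
  also have "\<dots> = (\<integral>\<^sup>+x. \<integral>\<^sup>+y. emeasure (K' x) A * emeasure (L' y) B \<partial>L y \<partial>K x)"
    by (subst Ky.M2.nn_integral_fst[symmetric]) auto
  also have "\<dots> = emeasure (K x \<bind> K') A * emeasure (L y \<bind> L') B"
    by (simp add: nn_integral_cmult nn_integral_multc
        emeasure_bind_prob_algebra[OF Kx(4) K'[unfolded markov_kernel_def] AB(1)]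
        emeasure_bind_prob_algebra[OF Ly(4) L'[unfolded markov_kernel_def] AB(2)])
  finally show "emeasure (K x \<bind> K') A * emeasure (L y \<bind> L') B
    = emeasure (tensor_kernel L K (x, y) \<bind> tensor_kernel L' K') (A \<times> B)" ..
qed

lemma markov_kernel_return: "markov_kernel M (return M)"
  by (simp add: markov_kernel_def)

text \<open>The operator of this kernel is the projection onto constants; both sides of detailed
  balance are the product of the masses of \<open>A\<close> and \<open>B\<close>.\<close>

lemma reversible_markov_const:
  assumes "prob_space M" shows "reversible_markov M (\<lambda>_. M)"
proof -
  interpret prob_space M by fact
  have "M \<in> space (prob_algebra M)"
    by (simp add: space_prob_algebra prob_space_axioms)
  moreover have "reversible_kernel M (\<lambda>_. M)"
    unfolding reversible_kernel_def by (simp add: nn_integral_cmult_indicator) (simp add: mult.commute)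
  ultimately show ?thesis
    by unfold_locales (simp_all add: markov_kernel_def)
qed

section \<open>Lifting a kernel from one coordinate to the product\<close>

text \<open>The second coordinate never moves, so for fixed \<open>y\<close> detailed balance for
  arbitrary measurable \<open>C\<close> and \<open>D\<close> is that of \<open>K\<close> for their
  sections at \<open>y\<close>, integrated over \<open>y\<close>.\<close>

lemma reversible_markov_tensor_left:
  assumes M: "reversible_markov M K" and N: "prob_space N"
  shows "reversible_markov (M \<Otimes>\<^sub>M N) (tensor_kernel (return N) K)"
proof -
  interpret K: reversible_markov M K by fact
  interpret N: prob_space N by fact
  interpret MN: pair_prob_space M N ..
  have eq: "(\<integral>\<^sup>+z\<in>C. emeasure (tensor_kernel (return N) K z) D \<partial>(M \<Otimes>\<^sub>M N))
    = (\<integral>\<^sup>+y. (\<integral>\<^sup>+x\<in>((\<lambda>x. (x, y)) -` C \<inter> space M). emeasure (K x) ((\<lambda>x. (x, y)) -` D \<inter> space M) \<partial>M) \<partial>N)"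
    if CD [measurable]: "C \<in> sets (M \<Otimes>\<^sub>M N)" "D \<in> sets (M \<Otimes>\<^sub>M N)" for C D
  proof -
    have [measurable]: "tensor_kernel (return N) K \<in> M \<Otimes>\<^sub>M N \<rightarrow>\<^sub>M subprob_algebra (M \<Otimes>\<^sub>M N)"
      using markov_kernel_tensor[OF markov_kernel_return K.markov]
      by (auto simp: markov_kernel_def intro: measurable_prob_algebraD)
    have eq: "(\<integral>\<^sup>+z\<in>C. emeasure (tensor_kernel (return N) K z) D \<partial>(M \<Otimes>\<^sub>M N))
      = (\<integral>\<^sup>+y. \<integral>\<^sup>+x. emeasure (tensor_kernel (return N) K (x, y)) D * indicator C (x, y) \<partial>M \<partial>N)"
      by (subst MN.nn_integral_snd[symmetric]) auto
    also have "\<dots> = (\<integral>\<^sup>+y. (\<integral>\<^sup>+x\<in>((\<lambda>x. (x, y)) -` C \<inter> space M). emeasure (K x) ((\<lambda>x. (x, y)) -` D \<inter> space M) \<partial>M) \<partial>N)"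
    proof (intro nn_integral_cong)
      fix x y assume y: "y \<in> space N" and x: "x \<in> space M"
      note Kx = markov_kernelD[OF K.markov x]
      have "emeasure (tensor_kernel (return N) K (x, y)) D = emeasure (K x) ((\<lambda>x. (x, y)) -` D \<inter> space M)"
        using y Kx CD by (simp add: tensor_kernel_def pair_return_right[OF y Kx(1,2)])
          (subst emeasure_distr; simp add: Kx measurable_cong_sets[OF Kx(2) refl])
      then show "emeasure (tensor_kernel (return N) K (x, y)) D * indicator C (x, y)
        = emeasure (K x) ((\<lambda>x. (x, y)) -` D \<inter> space M) * indicator ((\<lambda>x. (x, y)) -` C \<inter> space M) x"
        using x by (simp split: split_indicator)
    qed
    finally show ?thesis .
  qed
  have meas: "(\<lambda>x. (x, y)) -` C \<inter> space M \<in> sets M"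
    if "C \<in> sets (M \<Otimes>\<^sub>M N)" "y \<in> space N" for C y
    using that by measurable
  have "reversible_kernel (M \<Otimes>\<^sub>M N) (tensor_kernel (return N) K)"
    using K.reversible unfolding reversible_kernel_def
    by (intro ballI) (simp only: eq, rule nn_integral_cong, simp add: meas)
  then show ?thesis
    using markov_kernel_tensor[OF markov_kernel_return K.markov] by unfold_locales
qed

text \<open>The mirror image, with sections at fixed \<open>x\<close>.\<close>

lemma reversible_markov_tensor_right:
  assumes M: "prob_space M" and N: "reversible_markov N L"
  shows "reversible_markov (M \<Otimes>\<^sub>M N) (tensor_kernel L (return M))"
proof -
  interpret L: reversible_markov N L by fact
  interpret M: prob_space M by fact
  interpret MN: pair_prob_space M N ..
  have eq: "(\<integral>\<^sup>+z\<in>C. emeasure (tensor_kernel L (return M) z) D \<partial>(M \<Otimes>\<^sub>M N))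
    = (\<integral>\<^sup>+x. (\<integral>\<^sup>+y\<in>(Pair x -` C \<inter> space N). emeasure (L y) (Pair x -` D \<inter> space N) \<partial>N) \<partial>M)"
    if CD [measurable]: "C \<in> sets (M \<Otimes>\<^sub>M N)" "D \<in> sets (M \<Otimes>\<^sub>M N)" for C D
  proof -
    have [measurable]: "tensor_kernel L (return M) \<in> M \<Otimes>\<^sub>M N \<rightarrow>\<^sub>M subprob_algebra (M \<Otimes>\<^sub>M N)"
      using markov_kernel_tensor[OF L.markov markov_kernel_return]
      by (auto simp: markov_kernel_def intro: measurable_prob_algebraD)
    have eq: "(\<integral>\<^sup>+z\<in>C. emeasure (tensor_kernel L (return M) z) D \<partial>(M \<Otimes>\<^sub>M N))
      = (\<integral>\<^sup>+x. \<integral>\<^sup>+y. emeasure (tensor_kernel L (return M) (x, y)) D * indicator C (x, y) \<partial>N \<partial>M)"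
      by (subst L.nn_integral_fst[symmetric]) auto
    also have "\<dots> = (\<integral>\<^sup>+x. (\<integral>\<^sup>+y\<in>(Pair x -` C \<inter> space N). emeasure (L y) (Pair x -` D \<inter> space N) \<partial>N) \<partial>M)"
    proof (intro nn_integral_cong)
      fix x y assume y: "y \<in> space N" and x: "x \<in> space M"
      note Ly = markov_kernelD[OF L.markov y]
      have "emeasure (tensor_kernel L (return M) (x, y)) D = emeasure (L y) (Pair x -` D \<inter> space N)"
        using x Ly CD by (simp add: tensor_kernel_def pair_return_left[OF x Ly(1,2)])
          (subst emeasure_distr; simp add: Ly measurable_cong_sets[OF Ly(2) refl])
      then show "emeasure (tensor_kernel L (return M) (x, y)) D * indicator C (x, y)
        = emeasure (L y) (Pair x -` D \<inter> space N) * indicator (Pair x -` C \<inter> space N) y"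
        using y by (simp split: split_indicator)
    qed
    finally show ?thesis .
  qed
  have meas: "Pair x -` C \<inter> space N \<in> sets N"
    if "C \<in> sets (M \<Otimes>\<^sub>M N)" "x \<in> space M" for C x
    using that by measurable
  have "reversible_kernel (M \<Otimes>\<^sub>M N) (tensor_kernel L (return M))"
    using L.reversible unfolding reversible_kernel_def
    by (intro ballI) (simp only: eq, rule nn_integral_cong, simp add: meas)
  then show ?thesis
    using markov_kernel_tensor[OF L.markov markov_kernel_return] by unfold_locales
qed

text \<open>A change of variables along the section, valid at every point: for a non-integrable
  section both sides take the default value 0.\<close>

lemma kernel_op_tensor_left:
  assumes K: "markov_kernel M K" and [measurable]: "f \<in> borel_measurable (M \<Otimes>\<^sub>M N)"
    and x: "x \<in> space M" and y: "y \<in> space N"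
  shows "kernel_op (tensor_kernel (return N) K) f (x, y) = kernel_op K (\<lambda>x. f (x, y)) x"
proof -
  note Kx = markov_kernelD[OF K x]
  show ?thesis
    using y unfolding kernel_op_def tensor_kernel_def prod.case pair_return_right[OF y Kx(1,2)]
    by (intro integral_distr) (simp_all add: measurable_cong_sets[OF Kx(2) refl])
qed

lemma kernel_op_tensor_right:
  assumes L: "markov_kernel N L" and [measurable]: "f \<in> borel_measurable (M \<Otimes>\<^sub>M N)"
    and x: "x \<in> space M" and y: "y \<in> space N"
  shows "kernel_op (tensor_kernel L (return M)) f (x, y) = kernel_op L (\<lambda>y. f (x, y)) y"
proof -
  note Ly = markov_kernelD[OF L y]
  show ?thesis
    using x unfolding kernel_op_def tensor_kernel_def prod.case pair_return_left[OF x Ly(1,2)]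
    by (intro integral_distr) (simp_all add: measurable_cong_sets[OF Ly(2) refl])
qed

section \<open>Oscillation\<close>

lemma (in prob_space) osc_norm_finite:
  assumes [measurable]: "f \<in> borel_measurable M" and fin: "osc_norm M f \<noteq> \<infinity>"
  obtains a b where "AE x in M. a \<le> f x \<and> f x \<le> b" "osc_norm M f = ereal (b - a)" "a \<le> b"
proof -
  have 1: "AE x in M. ereal (f x) \<le> esssup M (\<lambda>x. ereal (f x))"
    "AE x in M. - ereal (f x) \<le> esssup M (\<lambda>x. - ereal (f x))"
    by (rule esssup_AE)+
  \<comment> \<open>On a probability space no real function is almost everywhere bounded by
    \<open>-\<infinity>\<close>. With both suprema above \<open>-\<infinity>\<close>, finiteness of
    their sum makes each of them finite.\<close>
  have ne: "esssup M (\<lambda>x. ereal (f x)) \<noteq> -\<infinity>" "esssup M (\<lambda>x. - ereal (f x)) \<noteq> -\<infinity>"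
    using 1 by (auto simp: AE_False)
  then obtain b a' where ab: "esssup M (\<lambda>x. ereal (f x)) = ereal b" "esssup M (\<lambda>x. - ereal (f x)) = ereal a'"
    using fin unfolding osc_norm_def essinf_def
    by (cases "esssup M (\<lambda>x. ereal (f x))"; cases "esssup M (\<lambda>x. - ereal (f x))") auto
  have ae: "AE x in M. - a' \<le> f x \<and> f x \<le> b"
    using 1 unfolding ab by eventually_elim auto
  moreover have "AE x in M. - a' \<le> b"
    using ae by eventually_elim linarith
  then have "- a' \<le> b"
    by (cases "- a' \<le> b") (auto simp: AE_False)
  moreover have "osc_norm M f = ereal (b - (- a'))"
    using ab by (simp add: osc_norm_def essinf_def)
  ultimately show thesis by (intro that[of "- a'" b])
qed

text \<open>Any almost sure bounds dominate the essential ones. Bounds for \<open>f\<close> on the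
  product are thereby inherited as oscillation bounds by its sections and averages.\<close>

lemma (in prob_space) osc_norm_le:
  assumes [measurable]: "f \<in> borel_measurable M" and ae: "AE x in M. a \<le> f x \<and> f x \<le> b"
  shows "0 \<le> osc_norm M f" "osc_norm M f \<le> ereal (b - a)"
proof -
  have 1: "esssup M (\<lambda>x. ereal (f x)) \<le> ereal b" "esssup M (\<lambda>x. - ereal (f x)) \<le> ereal (- a)"
    by (rule esssup_I; use ae in \<open>auto elim!: eventually_mono\<close>)+
  have "osc_norm M f \<le> ereal b + ereal (- a)"
    unfolding osc_norm_def essinf_def using add_mono[OF 1] by (simp add: minus_ereal_def)
  then show le: "osc_norm M f \<le> ereal (b - a)" by simp
  then have "osc_norm M f \<noteq> \<infinity>" by auto
  from osc_norm_finite[OF assms(1) this] obtain a' b' where "osc_norm M f = ereal (b' - a')" "a' \<le> b'"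
    by blast
  then show "0 \<le> osc_norm M f" by simp
qed

text \<open>The case \<open>\<beta> s = 0\<close> covers essentially unbounded \<open>f\<close>, where \<open>0 * \<infinity> = 0\<close>.\<close>

lemma weak_poincareD:
  assumes "reversible_markov M K" and wp: "weak_poincare M (kernel_square K) \<beta>"
    and s: "0 < s" "0 \<le> \<beta> s" and f: "f \<in> L2 M"
    and c: "\<beta> s = 0 \<or> (AE x in M. a \<le> f x \<and> f x \<le> b)"
  shows "L2_inner M f f - (integral\<^sup>L M f)\<^sup>2
    \<le> s * (L2_inner M f f - L2_inner M (kernel_op K f) (kernel_op K f)) + \<beta> s * (b - a)\<^sup>2"
proof -
  interpret reversible_markov M K by fact
  have var: "variance f = L2_inner M f f - (expectation f)\<^sup>2"
    using variance_eq[OF L2_integrable[OF f] L2_D(2)[OF f]] by (simp add: L2_inner_self)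
  have "ereal (variance f)
    \<le> ereal (s * dirichlet_form M (kernel_square K) f) + ereal (\<beta> s) * (osc_norm M f)\<^sup>2"
    using wp s(1) f unfolding weak_poincare_def by blast
  note le = this[unfolded var dirichlet_form_square[OF f]]
  have "ereal (\<beta> s) * (osc_norm M f)\<^sup>2 \<le> ereal (\<beta> s * (b - a)\<^sup>2)"
  proof (cases "\<beta> s = 0")
    case False
    with c have "AE x in M. a \<le> f x \<and> f x \<le> b" by simp
    \<comment> \<open>The oscillation is a nonnegative real here, so squaring its upper bound is
      monotone.\<close>
    note osc = osc_norm_le[OF L2_D(1)[OF f] this]
    then obtain d where "osc_norm M f = ereal d"
      by (cases "osc_norm M f") auto
    with osc s show ?thesis
      by (auto intro!: mult_left_mono power_mono)
  qed (simp add: zero_ereal_def[symmetric])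
  from order_trans[OF le add_left_mono[OF this]] show ?thesis by simp
qed

section \<open>Projections and energies\<close>

text \<open>Pythagoras: \<open>P\<close> is self-adjoint and idempotent, so the inner product of
  \<open>f\<close> with \<open>P f\<close> is the squared norm of \<open>P f\<close>.\<close>

lemma reversible_markov_projection:
  assumes P: "reversible_markov M P" and idem: "\<And>x. x \<in> space M \<Longrightarrow> P x \<bind> P = P x"
    and f: "f \<in> L2 M"
  shows "L2_inner M (\<lambda>x. f x - kernel_op P f x) (\<lambda>x. f x - kernel_op P f x)
    = L2_inner M f f - L2_inner M (kernel_op P f) (kernel_op P f)"
proof -
  interpret P: reversible_markov M P by fact
  have Pf: "kernel_op P f \<in> L2 M" by (rule P.kernel_op_L2[OF f])
  have "AE x in M. kernel_op P f x = kernel_op P (kernel_op P f) x"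
    by (rule P.kernel_op_bind[OF P P.L2_integrable[OF f] idem])
  then have "L2_inner M f (kernel_op P f) = L2_inner M f (kernel_op P (kernel_op P f))"
    by (intro L2_inner_cong_AE L2_D(1) f Pf P.kernel_op_L2) auto
  then show ?thesis
    using L2_inner_diff[OF f Pf] P.kernel_op_self_adjoint[OF f Pf] by simp
qed

text \<open>The energy \<open>\<parallel>g\<parallel>\<^sup>2 - \<parallel>A g\<parallel>\<^sup>2\<close> splits along the orthogonal decomposition \<open>g = P g + (g - P g)\<close>,
  and its second part is nonnegative because \<open>A\<close> is a contraction.\<close>

lemma reversible_markov_energy_projection_le:
  assumes P: "reversible_markov M P" and A: "reversible_markov M A"
    and idem: "\<And>x. x \<in> space M \<Longrightarrow> P x \<bind> P = P x"
    and comm: "\<And>x. x \<in> space M \<Longrightarrow> A x \<bind> P = P x \<bind> A"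
    and g: "g \<in> L2 M"
  shows "L2_inner M (kernel_op P g) (kernel_op P g)
      - L2_inner M (kernel_op A (kernel_op P g)) (kernel_op A (kernel_op P g))
    \<le> L2_inner M g g - L2_inner M (kernel_op A g) (kernel_op A g)"
proof -
  interpret P: reversible_markov M P by fact
  interpret A: reversible_markov M A by fact
  let ?N = "\<lambda>f. L2_inner M f f" and ?P = "kernel_op P" and ?A = "kernel_op A"
  note L2 = P.kernel_op_L2 A.kernel_op_L2 L2_diff
  \<comment> \<open>Commutation passes from kernels to operators by reading both products as the
    operator of one composite kernel.\<close>
  have "AE x in M. kernel_op (\<lambda>x. A x \<bind> P) g x = ?A (?P g) x"
    by (rule A.kernel_op_bind[OF P P.L2_integrable[OF g] refl])
  moreover have "AE x in M. kernel_op (\<lambda>x. A x \<bind> P) g x = ?P (?A g) x"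
    by (rule P.kernel_op_bind[OF A P.L2_integrable[OF g] comm[symmetric]])
  ultimately have AP: "AE x in M. ?A (?P g) x = ?P (?A g) x"
    by eventually_elim simp
  have "?N (?A g) - ?N (?A (?P g)) = ?N (?A g) - ?N (?P (?A g))"
    by (intro arg_cong2[where f = "(-)"] refl L2_inner_cong_AE L2_D(1) L2 g AP)
  \<comment> \<open>Pythagoras for \<open>P\<close> at \<open>A g\<close>; by commutation the
    residual is \<open>A\<close> applied to \<open>g - P g\<close>, to which the contraction
    property applies.\<close>
  also have "\<dots> = ?N (\<lambda>x. ?A g x - ?P (?A g) x)"
    by (intro reversible_markov_projection[symmetric] P idem L2 g)
  also have "\<dots> = ?N (?A (\<lambda>x. g x - ?P g x))"
  proof -
    have "AE x in M. ?A g x - ?P (?A g) x = ?A (\<lambda>x. g x - ?P g x) x"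
      using A.kernel_op_diff[OF P.L2_integrable[OF g] P.L2_integrable[OF L2(1)[OF g]]] AP
      by eventually_elim simp
    then show ?thesis
      by (intro L2_inner_cong_AE L2_D(1) L2 g)
  qed
  also have "\<dots> \<le> ?N (\<lambda>x. g x - ?P g x)"
    by (intro A.kernel_op_contraction L2 g)
  also have "\<dots> = ?N g - ?N (?P g)"
    by (rule reversible_markov_projection[OF P idem g])
  finally show ?thesis by simp
qed

section \<open>The product chain\<close>

text \<open>In the theorem \<open>K\<close> is \<open>H2\<close> on the first coordinate and
  \<open>L\<close> is \<open>H1\<close> on the second, so the product chain reads
  \<open>tensor_kernel L K\<close>.\<close>

locale product_chain = X: reversible_markov M K + Y: reversible_markov N L
  for M :: "'a measure" and N :: "'b measure" and K L
begin

sublocale MN: pair_prob_space M N ..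

text \<open>These three kernels realise the operators \<open>A\<close>, \<open>B\<close> and
  \<open>P\<close> of the overview.\<close>

abbreviation "kernelX \<equiv> tensor_kernel (return N) K"
abbreviation "kernelY \<equiv> tensor_kernel L (return M)"
abbreviation "averageY \<equiv> tensor_kernel (\<lambda>_. N) (return M)"

lemma reversible_kernelX: "reversible_markov (M \<Otimes>\<^sub>M N) kernelX"
  by (intro reversible_markov_tensor_left) unfold_locales

lemma reversible_kernelY: "reversible_markov (M \<Otimes>\<^sub>M N) kernelY"
  by (intro reversible_markov_tensor_right) unfold_locales

lemma reversible_averageY: "reversible_markov (M \<Otimes>\<^sub>M N) averageY"
  by (intro reversible_markov_tensor_right reversible_markov_const) unfold_locales

sublocale kX: reversible_markov "M \<Otimes>\<^sub>M N" kernelX by (rule reversible_kernelX)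
sublocale kY: reversible_markov "M \<Otimes>\<^sub>M N" kernelY by (rule reversible_kernelY)
sublocale av: reversible_markov "M \<Otimes>\<^sub>M N" averageY by (rule reversible_averageY)

text \<open>Coordinatewise, \<open>return\<close> is neutral on both sides, \<open>N\<close> is
  invariant under \<open>L\<close>, and averaging twice is averaging once. As operators:
  \<open>A B = B A\<close>, \<open>P P = P\<close>, \<open>P B = P\<close> and
  \<open>A P = P A\<close>.\<close>

lemma kernel_bind_simps:
  assumes z: "z \<in> space (M \<Otimes>\<^sub>M N)"
  shows "kernelX z \<bind> kernelY = tensor_kernel L K z" "kernelY z \<bind> kernelX = tensor_kernel L K z"
    "averageY z \<bind> averageY = averageY z" "averageY z \<bind> kernelY = averageY z"
    "kernelX z \<bind> averageY = averageY z \<bind> kernelX"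
proof -
  obtain x y where xy: "z = (x, y)" "x \<in> space M" "y \<in> space N"
    using z by (auto simp: space_pair_measure)
  have NN: "markov_kernel N (\<lambda>_. N)"
    by (rule reversible_markov.markov[OF reversible_markov_const]) unfold_locales
  note b = tensor_kernel_bind[OF _ _ _ _ xy(2,3)]
  note r = bind_return[OF X.kernel_subprob xy(2)] bind_return[OF Y.kernel_subprob xy(3)]
    bind_return[OF return_measurable xy(2)] bind_return''[OF X.sets_kernel_eq[OF xy(2)]]
    bind_return''[OF Y.sets_kernel_eq[OF xy(3)]] bind_return''[of N N, OF refl]
    bind_return[OF measurable_prob_algebraD[OF NN[unfolded markov_kernel_def]] xy(3)]
    bind_const'[OF Y.prob_space_axioms prob_space_imp_subprob_space[OF Y.prob_space_axioms]]
    Y.bind_kernel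
  note k = X.markov Y.markov markov_kernel_return NN
  show "kernelX z \<bind> kernelY = tensor_kernel L K z"
    unfolding xy(1) b[OF k(1,3,3,2)] by (simp add: r tensor_kernel_def)
  show "kernelY z \<bind> kernelX = tensor_kernel L K z"
    unfolding xy(1) b[OF k(3,1,2,3)] by (simp add: r tensor_kernel_def)
  show "averageY z \<bind> averageY = averageY z"
    unfolding xy(1) b[OF k(3,3,4,4)] by (simp add: r tensor_kernel_def)
  show "averageY z \<bind> kernelY = averageY z"
    unfolding xy(1) b[OF k(3,3,4,2)] by (simp add: r tensor_kernel_def)
  show "kernelX z \<bind> averageY = averageY z \<bind> kernelX"
    unfolding xy(1) b[OF k(1,3,3,4)] b[OF k(3,1,4,3)] by (simp add: r)
qed

lemma reversible_tensor: "reversible_markov (M \<Otimes>\<^sub>M N) (tensor_kernel L K)"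
  by (rule reversible_markov_bind[OF reversible_kernelX reversible_kernelY kernel_bind_simps(1,2)])

text \<open>Averaging over the second coordinate does not see \<open>kernelY\<close>, so
  \<open>P f\<close> can be replaced by \<open>P (B f)\<close>; the energy bound for a projection
  commuting with \<open>A\<close> is then applied at \<open>B f\<close>.\<close>

lemma tensor_energy_ge:
  assumes f: "f \<in> L2 (M \<Otimes>\<^sub>M N)"
  shows "L2_inner (M \<Otimes>\<^sub>M N) (kernel_op averageY f) (kernel_op averageY f)
      - L2_inner (M \<Otimes>\<^sub>M N) (kernel_op kernelX (kernel_op averageY f)) (kernel_op kernelX (kernel_op averageY f))
    \<le> L2_inner (M \<Otimes>\<^sub>M N) (kernel_op kernelY f) (kernel_op kernelY f)
      - L2_inner (M \<Otimes>\<^sub>M N) (kernel_op (tensor_kernel L K) f) (kernel_op (tensor_kernel L K) f)"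
proof -
  interpret T: reversible_markov "M \<Otimes>\<^sub>M N" "tensor_kernel L K" by (rule reversible_tensor)
  let ?N = "\<lambda>f. L2_inner (M \<Otimes>\<^sub>M N) f f"
  let ?A = "kernel_op kernelX" and ?B = "kernel_op kernelY" and ?P = "kernel_op averageY"
  note L2 = kX.kernel_op_L2 kY.kernel_op_L2 av.kernel_op_L2 T.kernel_op_L2
  have T: "AE z in M \<Otimes>\<^sub>M N. kernel_op (tensor_kernel L K) f z = ?A (?B f) z"
    by (rule kX.kernel_op_bind[OF reversible_kernelY MN.L2_integrable[OF f] kernel_bind_simps(1)])
  have PB: "AE z in M \<Otimes>\<^sub>M N. ?P f z = ?P (?B f) z"
    by (rule av.kernel_op_bind[OF reversible_kernelY MN.L2_integrable[OF f] kernel_bind_simps(4)])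
  have APB: "AE z in M \<Otimes>\<^sub>M N. ?A (?P f) z = ?A (?P (?B f)) z"
    by (intro kX.kernel_op_cong_AE L2_D(1) L2 f PB)
  have "?N (?P f) - ?N (?A (?P f)) = ?N (?P (?B f)) - ?N (?A (?P (?B f)))"
    by (intro arg_cong2[where f = "(-)"] L2_inner_cong_AE L2_D(1) L2 f PB APB)
  also have "\<dots> \<le> ?N (?B f) - ?N (?A (?B f))"
    by (intro reversible_markov_energy_projection_le reversible_averageY reversible_kernelX
          kernel_bind_simps(3,5) L2 f)
  also have "\<dots> = ?N (?B f) - ?N (kernel_op (tensor_kernel L K) f)"
    by (intro arg_cong2[where f = "(-)"] refl L2_inner_cong_AE[symmetric] L2_D(1) L2 f T)
  finally show ?thesis .
qed

lemma averageY_eq: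
  assumes "f \<in> borel_measurable (M \<Otimes>\<^sub>M N)" "x \<in> space M" "y \<in> space N"
  shows "kernel_op averageY f (x, y) = (\<integral>y. f (x, y) \<partial>N)"
proof -
  have "markov_kernel N (\<lambda>_. N)"
    by (rule reversible_markov.markov[OF reversible_markov_const]) unfold_locales
  from kernel_op_tensor_right[OF this assms] show ?thesis
    by (simp add: kernel_op_def)
qed

section \<open>The two weak Poincare inequalities on the product\<close>

lemma L2_section:
  assumes f: "f \<in> L2 (M \<Otimes>\<^sub>M N)"
  shows "AE x in M. (\<lambda>y. f (x, y)) \<in> L2 N"
  using AE_space MN.AE_integrable_fst'[OF L2_D(2)[OF f]]
proof eventually_elim
  case (elim x)
  note [measurable] = elim(1) L2_D(1)[OF f]
  show ?case using elim(2) by (simp add: L2_def)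
qed

lemma L2_inner_pair:
  assumes f: "f \<in> L2 (M \<Otimes>\<^sub>M N)"
  shows "has_bochner_integral M (\<lambda>x. \<integral>y. (f (x, y))\<^sup>2 \<partial>N) (L2_inner (M \<Otimes>\<^sub>M N) f f)"
  using MN.integrable_fst'[OF L2_D(2)[OF f]] MN.integral_fst'[OF L2_D(2)[OF f]]
  by (simp add: has_bochner_integral_iff L2_inner_self)

lemma weak_poincare_sections:
  assumes wp: "weak_poincare N (kernel_square L) \<beta>" and s: "0 < s" "0 \<le> \<beta> s"
    and f: "f \<in> L2 (M \<Otimes>\<^sub>M N)"
    and c: "\<beta> s = 0 \<or> (AE z in M \<Otimes>\<^sub>M N. a \<le> f z \<and> f z \<le> b)"
  shows "L2_inner (M \<Otimes>\<^sub>M N) f f - L2_inner (M \<Otimes>\<^sub>M N) (kernel_op averageY f) (kernel_op averageY f)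
    \<le> s * (L2_inner (M \<Otimes>\<^sub>M N) f f - L2_inner (M \<Otimes>\<^sub>M N) (kernel_op kernelY f) (kernel_op kernelY f))
      + \<beta> s * (b - a)\<^sup>2"
proof -
  let ?I = "\<lambda>f x. \<integral>y. (f (x, y))\<^sup>2 \<partial>N"
  let ?P = "kernel_op averageY f" and ?B = "kernel_op kernelY f"
  note If = L2_inner_pair[OF f] and IP = L2_inner_pair[OF av.kernel_op_L2[OF f]]
    and IB = L2_inner_pair[OF kY.kernel_op_L2[OF f]]
  \<comment> \<open>Almost sure bounds on the product hold on almost every section, so one constant
    \<open>b - a\<close> bounds the oscillation of all these sections.\<close>
  have c': "AE x in M. \<beta> s = 0 \<or> (AE y in N. a \<le> f (x, y) \<and> f (x, y) \<le> b)"
    using c MN.AE_pair[of "\<lambda>z. a \<le> f z \<and> f z \<le> b"] by auto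
  have ae: "AE x in M. ?I f x - ?I ?P x \<le> s * (?I f x - ?I ?B x) + \<beta> s * (b - a)\<^sup>2"
    using AE_space L2_section[OF f] c'
  proof eventually_elim
    case (elim x)
    \<comment> \<open>On a section \<open>P f\<close> is constant and equal to the section mean, so
      this term turns the second moment into the variance.\<close>
    have "?I ?P x = (\<integral>y. (\<integral>y. f (x, y) \<partial>N)\<^sup>2 \<partial>N)"
      by (intro Bochner_Integration.integral_cong) (simp_all add: averageY_eq L2_D(1)[OF f] elim(1))
    then have "?I ?P x = (\<integral>y. f (x, y) \<partial>N)\<^sup>2"
      by (simp add: Y.prob_space)
    moreover have "?I ?B x = L2_inner N (kernel_op L (\<lambda>y. f (x, y))) (kernel_op L (\<lambda>y. f (x, y)))"
      unfolding L2_inner_self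
      by (intro Bochner_Integration.integral_cong)
         (simp_all add: kernel_op_tensor_right[OF Y.markov L2_D(1)[OF f] elim(1)])
    ultimately show ?case
      using weak_poincareD[OF Y.reversible_markov_axioms wp s elim(2,3)] by (simp add: L2_inner_self)
  qed
  have C: "has_bochner_integral M (\<lambda>x. \<beta> s * (b - a)\<^sup>2) (\<beta> s * (b - a)\<^sup>2)"
    by (simp add: has_bochner_integral_iff X.prob_space)
  have l: "has_bochner_integral M (\<lambda>x. ?I f x - ?I ?P x)
      (L2_inner (M \<Otimes>\<^sub>M N) f f - L2_inner (M \<Otimes>\<^sub>M N) ?P ?P)"
    by (rule has_bochner_integral_diff[OF If IP])
  have r: "has_bochner_integral M (\<lambda>x. s * (?I f x - ?I ?B x) + \<beta> s * (b - a)\<^sup>2)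
      (s * (L2_inner (M \<Otimes>\<^sub>M N) f f - L2_inner (M \<Otimes>\<^sub>M N) ?B ?B) + \<beta> s * (b - a)\<^sup>2)"
    by (rule has_bochner_integral_add[OF has_bochner_integral_mult_right[OF has_bochner_integral_diff[OF If IB]] C])
  show ?thesis
    using has_bochner_integral_mono_AE[OF l r ae] .
qed

text \<open>\<open>P f\<close> depends on the first coordinate only, through \<open>F\<close>; norms
  on the product become norms on \<open>M\<close>, and the inequality for \<open>K\<close> applies
  to \<open>F\<close>.\<close>

lemma weak_poincare_averages:
  assumes wp: "weak_poincare M (kernel_square K) \<beta>" and s: "0 < s" "0 \<le> \<beta> s"
    and f0: "f \<in> L2_0 (M \<Otimes>\<^sub>M N)"
    and c: "\<beta> s = 0 \<or> (AE z in M \<Otimes>\<^sub>M N. a \<le> f z \<and> f z \<le> b)"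
  shows "L2_inner (M \<Otimes>\<^sub>M N) (kernel_op averageY f) (kernel_op averageY f)
    \<le> s * (L2_inner (M \<Otimes>\<^sub>M N) (kernel_op averageY f) (kernel_op averageY f)
        - L2_inner (M \<Otimes>\<^sub>M N) (kernel_op kernelX (kernel_op averageY f)) (kernel_op kernelX (kernel_op averageY f)))
      + \<beta> s * (b - a)\<^sup>2"
proof -
  have f: "f \<in> L2 (M \<Otimes>\<^sub>M N)"
    using f0 by (simp add: L2_0_def)
  have mean: "integral\<^sup>L (M \<Otimes>\<^sub>M N) f = 0"
    using f0 by (simp add: L2_0_def)
  note [measurable] = L2_D(1)[OF f]
  define F where "F x = (\<integral>y. f (x, y) \<partial>N)" for x
  let ?P = "kernel_op averageY f" and ?A = "kernel_op kernelX"
  have P: "?P \<in> L2 (M \<Otimes>\<^sub>M N)" and AP: "?A ?P \<in> L2 (M \<Otimes>\<^sub>M N)"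
    by (intro av.kernel_op_L2 kX.kernel_op_L2 f)+
  have IF: "(\<integral>y. (?P (x, y))\<^sup>2 \<partial>N) = (F x)\<^sup>2" if "x \<in> space M" for x
  proof -
    have "(\<integral>y. (?P (x, y))\<^sup>2 \<partial>N) = (\<integral>y. (F x)\<^sup>2 \<partial>N)"
      by (intro Bochner_Integration.integral_cong) (simp_all add: averageY_eq[OF L2_D(1)[OF f]] that F_def)
    then show ?thesis by (simp add: Y.prob_space)
  qed
  have "?A ?P (x, y) = kernel_op K F x" if x: "x \<in> space M" and y: "y \<in> space N" for x y
    unfolding kernel_op_tensor_left[OF X.markov L2_D(1)[OF P] x y]
    unfolding kernel_op_def[of K]
    by (intro Bochner_Integration.integral_cong)
       (simp_all add: averageY_eq[OF L2_D(1)[OF f]] y F_def markov_kernelD(3)[OF X.markov x])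
  then have "(\<integral>y. (?A ?P (x, y))\<^sup>2 \<partial>N) = (\<integral>y. (kernel_op K F x)\<^sup>2 \<partial>N)" if "x \<in> space M" for x
    using that by (intro Bochner_Integration.integral_cong) auto
  then have IKF: "(\<integral>y. (?A ?P (x, y))\<^sup>2 \<partial>N) = (kernel_op K F x)\<^sup>2" if "x \<in> space M" for x
    using that by (simp add: Y.prob_space)
  have hF: "has_bochner_integral M (\<lambda>x. (F x)\<^sup>2) (L2_inner (M \<Otimes>\<^sub>M N) ?P ?P)"
    by (rule has_bochner_integral_cong[THEN iffD1, OF refl IF refl L2_inner_pair[OF P]])
  have "has_bochner_integral M (\<lambda>x. (kernel_op K F x)\<^sup>2) (L2_inner (M \<Otimes>\<^sub>M N) (?A ?P) (?A ?P))"
    by (rule has_bochner_integral_cong[THEN iffD1, OF refl IKF refl L2_inner_pair[OF AP]])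
  then have KF: "L2_inner M (kernel_op K F) (kernel_op K F) = L2_inner (M \<Otimes>\<^sub>M N) (?A ?P) (?A ?P)"
    by (simp add: L2_inner_self has_bochner_integral_iff)
  have [measurable]: "F \<in> borel_measurable M"
    unfolding F_def by measurable
  have F: "F \<in> L2 M"
    using hF by (simp add: L2_def has_bochner_integral_iff)
  have FF: "L2_inner M F F = L2_inner (M \<Otimes>\<^sub>M N) ?P ?P"
    using hF by (simp add: L2_inner_self has_bochner_integral_iff)
  \<comment> \<open>The mean of \<open>f\<close> is inherited by \<open>F\<close>, so the squared
    mean in the inequality for \<open>K\<close> vanishes.\<close>
  have F0: "integral\<^sup>L M F = 0"
    using MN.integral_fst'[OF MN.L2_integrable[OF f]] mean by (simp add: F_def[abs_def])
  \<comment> \<open>Averaging against a probability measure preserves bounds, so \<open>F\<close>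
    oscillates by at most \<open>b - a\<close>.\<close>
  have "AE x in M. a \<le> F x \<and> F x \<le> b" if "AE z in M \<Otimes>\<^sub>M N. a \<le> f z \<and> f z \<le> b"
    using MN.AE_pair[OF that] MN.AE_integrable_fst'[OF MN.L2_integrable[OF f]]
  proof eventually_elim
    case (elim x)
    then show ?case
      unfolding F_def by (intro conjI Y.integral_ge_const Y.integral_le_const) auto
  qed
  with c have "\<beta> s = 0 \<or> (AE x in M. a \<le> F x \<and> F x \<le> b)" by blast
  from weak_poincareD[OF X.reversible_markov_axioms wp s F this] show ?thesis
    by (simp add: FF F0 KF)
qed

end

theorem theorem4p1:
  fixes \<Pi>X :: "'a measure" and \<Pi>Y :: "'b measure"
    and H1 :: "'b \<Rightarrow> 'b measure" and H2 :: "'a \<Rightarrow> 'a measure"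
    and \<beta>1 \<beta>2 :: "real \<Rightarrow> real"
  assumes "prob_space \<Pi>X" and "prob_space \<Pi>Y"
    and "markov_kernel \<Pi>Y H1" and "reversible_kernel \<Pi>Y H1" and "positive_kernel \<Pi>Y H1"
    and "markov_kernel \<Pi>X H2" and "reversible_kernel \<Pi>X H2" and "positive_kernel \<Pi>X H2"
    and "admissible \<beta>1" and "admissible \<beta>2"
    and "weak_poincare \<Pi>Y (kernel_square H1) \<beta>1"
    and "weak_poincare \<Pi>X (kernel_square H2) \<beta>2"
  shows "\<forall>s>0. \<forall>f\<in>L2_0 (\<Pi>X \<Otimes>\<^sub>M \<Pi>Y).
           ereal (L2_inner (\<Pi>X \<Otimes>\<^sub>M \<Pi>Y) f f)
             \<le> ereal (s * dirichlet_form (\<Pi>X \<Otimes>\<^sub>M \<Pi>Y) (kernel_square (tensor_kernel H1 H2)) f)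
               + ereal (\<beta>1 s + \<beta>2 s) * (osc_norm (\<Pi>X \<Otimes>\<^sub>M \<Pi>Y) f)\<^sup>2"
proof (intro allI impI ballI)
  fix s :: real and f assume s: "s > 0" and f0: "f \<in> L2_0 (\<Pi>X \<Otimes>\<^sub>M \<Pi>Y)"
  interpret product_chain \<Pi>X \<Pi>Y H2 H1
    using assms(1-4,6,7)
    by (simp add: product_chain_def reversible_markov_def reversible_markov_axioms_def)
  let ?N = "\<lambda>f. L2_inner (\<Pi>X \<Otimes>\<^sub>M \<Pi>Y) f f"
  have f: "f \<in> L2 (\<Pi>X \<Otimes>\<^sub>M \<Pi>Y)" using f0 by (simp add: L2_0_def)
  have \<beta>: "0 \<le> \<beta>1 s" "0 \<le> \<beta>2 s"
    using assms(9,10) s by (auto simp: admissible_def)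
  have D: "dirichlet_form (\<Pi>X \<Otimes>\<^sub>M \<Pi>Y) (kernel_square (tensor_kernel H1 H2)) f
    = ?N f - ?N (kernel_op (tensor_kernel H1 H2) f)"
    by (rule reversible_markov.dirichlet_form_square[OF reversible_tensor f])
  \<comment> \<open>The real inequality, kept apart from the extended reals: either bounds
    \<open>a\<close> and \<open>b\<close> are available or the oscillation term vanishes.\<close>
  have main: "?N f \<le> s * (?N f - ?N (kernel_op (tensor_kernel H1 H2) f)) + (\<beta>1 s + \<beta>2 s) * (b - a)\<^sup>2"
    if "\<beta>1 s = 0 \<and> \<beta>2 s = 0 \<or> (AE z in \<Pi>X \<Otimes>\<^sub>M \<Pi>Y. a \<le> f z \<and> f z \<le> b)" for a b
  proof -
    have 1: "\<beta>1 s = 0 \<or> (AE z in \<Pi>X \<Otimes>\<^sub>M \<Pi>Y. a \<le> f z \<and> f z \<le> b)"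
      and 2: "\<beta>2 s = 0 \<or> (AE z in \<Pi>X \<Otimes>\<^sub>M \<Pi>Y. a \<le> f z \<and> f z \<le> b)"
      using that by auto
    \<comment> \<open>In the sum of the two inequalities the squared norm of \<open>P f\<close>
      cancels on the left. On the right the energy comparison, scaled by \<open>s\<close>, replaces
      the energy of \<open>P f\<close>, and the squared norm of \<open>B f\<close> cancels.\<close>
    note weak_poincare_sections[OF assms(11) s \<beta>(1) f 1]
      weak_poincare_averages[OF assms(12) s \<beta>(2) f0 2]
      mult_left_mono[OF tensor_energy_ge[OF f] less_imp_le[OF s]]
    then show ?thesis
      by (simp add: algebra_simps)
  qed
  \<comment> \<open>The cases follow the convention \<open>0 * \<infinity> = 0\<close>: a vanishing
    coefficient, where \<open>a\<close> and \<open>b\<close> are arbitrary; a finite oscillation;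
    and an infinite right-hand side.\<close>
  consider "\<beta>1 s = 0 \<and> \<beta>2 s = 0" | "osc_norm (\<Pi>X \<Otimes>\<^sub>M \<Pi>Y) f \<noteq> \<infinity>"
    | "0 < \<beta>1 s + \<beta>2 s" "osc_norm (\<Pi>X \<Otimes>\<^sub>M \<Pi>Y) f = \<infinity>"
    using \<beta> by linarith
  then show "ereal (?N f)
      \<le> ereal (s * dirichlet_form (\<Pi>X \<Otimes>\<^sub>M \<Pi>Y) (kernel_square (tensor_kernel H1 H2)) f)
        + ereal (\<beta>1 s + \<beta>2 s) * (osc_norm (\<Pi>X \<Otimes>\<^sub>M \<Pi>Y) f)\<^sup>2"
  proof cases
    case 1
    then show ?thesis
      using main[of 0 0] by (simp add: D zero_ereal_def[symmetric])
  next
    case 2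
    from MN.osc_norm_finite[OF L2_D(1)[OF f] this] obtain a b where
      "AE z in \<Pi>X \<Otimes>\<^sub>M \<Pi>Y. a \<le> f z \<and> f z \<le> b" "osc_norm (\<Pi>X \<Otimes>\<^sub>M \<Pi>Y) f = ereal (b - a)"
      by blast
    with main[of a b] show ?thesis
      by (simp add: D)
  next
    case 3
    then show ?thesis by (simp add: power2_eq_square)
  qed
qed

end
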